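(* The minimal disks $\Sigma_a=F_a(\Omega_a)$, $a\in(0,1/2]$, cannot be properly embedded in any growing sequence of open sets in $\mathbb R^3$ that exhausts $\mathbb R^3$. That is: for every sequence $(a_i)_{i\in\mathbb N}$ in $(0,1/2]$ and every sequence of open sets $U_1\subset U_2\subset\cdots\subset\mathbb R^3$ with $\bigcup_i U_i=\mathbb R^3$, it is not the case that $\Sigma_{a_i}$ is properly embedded in $U_i$ for every $i$.
   Context: Identify $\mathbb C$ with $\mathbb R^2$ via $z=x+iy$. Let $x_A=\frac{4+\pi}{6\pi}$ and $x_B=\frac{1+\pi}{3\pi}$. For $a\in(0,1/2]$ and $x\in\mathbb R$ define $$y_{x,a}=\begin{cases}\frac{(x^2+a^2)^{3/4}}{2}, & |x|\le x_A,\\[2pt] y_A+(y_B-y_A)\frac{|x|-x_A}{x_B-x_A}, & x_A\le|x|\le x_B,\\[2pt] \frac{(x^2+a^2)^{1/2}}{2}, & |x|\ge x_B,\end{cases}$$ where $y_A=\frac{(x_A^2+a^2)^{3/4}}{2}$ and $y_B=\frac{(x_B^2+a^2)^{1/2}}{2}$, and let $\Omega_a=\{(x,y)\in\mathbb R^2\mid |y|\le y_{x,a}\}$. This is a simply connected closed region not containing $\pm ia$. Let $h_a(z)=\frac1a\arctan\left(\frac za\right)$ on $\Omega_a$ (the holomorphic branch with $h_a(0)=0$, so $h_a'(z)=\frac{1}{z^2+a^2}$), and $g_a=e^{ih_a}$. Let $F_a:\Omega_a\to\mathbb R^3$ be the conformal minimal immersion $$F_a(z)=\mathrm{Re}\int_0^z\left(\tfrac12\big(g_a^{-1}(\zeta)-g_a(\zeta)\big),\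 \tfrac i2\big(g_a^{-1}(\zeta)+g_a(\zeta)\big),\ 1\right)d\zeta,$$ the integral being along any path in $\Omega_a$, and $\Sigma_a=F_a(\Omega_a)$; $F_a$ is an embedding, with $F_a(x,0)=(0,0,x)$ for $x\in\mathbb R$. The boundary of $\Sigma_a$ is $\partial\Sigma_a=F_a(\partial\Omega_a)=\{F_a(x,\pm y_{x,a})\mid x\in\mathbb R\}$. $\Sigma_a$ is said to be properly embedded in an open set $U\subset\mathbb R^3$ if $\Sigma_a\cap U$ is an embedded surface without boundary in $U$ (i.e. $\partial\Sigma_a\cap U=\emptyset$) whose inclusion into $U$ is proper. *)

theory Defs
  imports "HOL-Complex_Analysis.Complex_Analysis"
begin

definition xA :: real where
  "xA = (4 + pi) / (6 * pi)"

definition xB :: real where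
  "xB = (1 + pi) / (3 * pi)"

definition yA :: "real \<Rightarrow> real" where
  "yA a = (xA\<^sup>2 + a\<^sup>2) powr (3/4) / 2"

definition yB :: "real \<Rightarrow> real" where
  "yB a = (xB\<^sup>2 + a\<^sup>2) powr (1/2) / 2"

definition ybound :: "real \<Rightarrow> real \<Rightarrow> real" where
  "ybound a x =
     (if \<bar>x\<bar> \<le> xA then (x\<^sup>2 + a\<^sup>2) powr (3/4) / 2
      else if \<bar>x\<bar> \<le> xB then yA a + (yB a - yA a) * ((\<bar>x\<bar> - xA) / (xB - xA))
      else (x\<^sup>2 + a\<^sup>2) powr (1/2) / 2)"

definition Omega :: "real \<Rightarrow> complex set" where
  "Omega a = {z. \<bar>Im z\<bar> \<le> ybound a (Re z)}"

text \<open>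
  The cuts of the principal branch \<^const>\<open>Arctan\<close> lie on the imaginary axis, at distance at
  least 1 from 0. For \<open>0 < a \<le> 1/2\<close> the set \<open>Omega a\<close> meets the imaginary axis only in points
  of modulus at most \<open>a powr (3/2) / 2 < a\<close>, so \<open>h a\<close> is the holomorphic branch on \<open>Omega a\<close>
  that vanishes at 0.
\<close>

definition h :: "real \<Rightarrow> complex \<Rightarrow> complex" where
  "h a z = Arctan (z / of_real a) / of_real a"

definition g :: "real \<Rightarrow> complex \<Rightarrow> complex" where
  "g a z = exp (\<i> * h a z)"

definition path_in_Omega :: "real \<Rightarrow> complex \<Rightarrow> (real \<Rightarrow> complex) \<Rightarrow> bool" where
  "path_in_Omega a z \<gamma> \<longleftrightarrow>
     valid_path \<gamma> \<and> path_image \<gamma> \<subseteq> Omega a \<and> pathstart \<gamma> = 0 \<and> pathfinish \<gamma> = z"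

definition F_along :: "real \<Rightarrow> (real \<Rightarrow> complex) \<Rightarrow> real ^ 3" where
  "F_along a \<gamma> = vector
     [Re (contour_integral \<gamma> (\<lambda>\<zeta>. 1/2 * (inverse (g a \<zeta>) - g a \<zeta>))),
      Re (contour_integral \<gamma> (\<lambda>\<zeta>. \<i>/2 * (inverse (g a \<zeta>) + g a \<zeta>))),
      Re (contour_integral \<gamma> (\<lambda>\<zeta>. 1))]"

text \<open>
  The choice of the path is immaterial: see \<open>F_eq_F_along\<close> below.
\<close>

definition F :: "real \<Rightarrow> complex \<Rightarrow> real ^ 3" where
  "F a z = F_along a (SOME \<gamma>. path_in_Omega a z \<gamma>)"

definition Sigma_surf :: "real \<Rightarrow> (real ^ 3) set" where
  "Sigma_surf a = F a ` Omega a"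

definition Sigma_bdry :: "real \<Rightarrow> (real ^ 3) set" where
  "Sigma_bdry a = F a ` frontier (Omega a)"

text \<open>
  \<open>C_on k D f\<close>: all partial derivatives of \<open>f\<close> of order at most \<open>k\<close> exist and are
  continuous on the open set \<open>D\<close>.
\<close>

primrec C_on ::
    "nat \<Rightarrow> 'a::euclidean_space set \<Rightarrow> ('a \<Rightarrow> 'b::real_normed_vector) \<Rightarrow> bool" where
  "C_on 0 D f \<longleftrightarrow> continuous_on D f"
| "C_on (Suc k) D f \<longleftrightarrow>
     (\<forall>x\<in>D. f differentiable (at x)) \<and>
     (\<forall>v\<in>Basis. C_on k D (\<lambda>x. frechet_derivative f (at x) v))"

definition smooth_on :: "'a::euclidean_space set \<Rightarrow> ('a \<Rightarrow> 'b::real_normed_vector) \<Rightarrow> bool" where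
  "smooth_on D f \<longleftrightarrow> (\<forall>k. C_on k D f)"

text \<open>
  An embedded surface (without boundary) is a regular surface in the classical sense: it is
  locally the homeomorphic image of an open subset of the plane under a smooth immersion.
\<close>

definition embedded_surface :: "(real ^ 3) set \<Rightarrow> bool" where
  "embedded_surface S \<longleftrightarrow>
     (\<forall>p\<in>S. \<exists>V D (\<phi> :: real ^ 2 \<Rightarrow> real ^ 3) \<psi>.
        open V \<and> p \<in> V \<and> open D \<and> smooth_on D \<phi> \<and>
        (\<forall>u\<in>D. inj (frechet_derivative \<phi> (at u))) \<and>
        homeomorphism D (S \<inter> V) \<phi> \<psi>)"

definition Sigma_properly_embedded_in :: "real \<Rightarrow> (real ^ 3) set \<Rightarrow> bool" where
  "Sigma_properly_embedded_in a U \<longleftrightarrow>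
     embedded_surface (Sigma_surf a \<inter> U) \<and>
     Sigma_bdry a \<inter> U = {} \<and>
     proper_map (top_of_set (Sigma_surf a \<inter> U)) (top_of_set U) id"

lemma Omega_avoids_cut:
  assumes a: "0 < a" "a \<le> 1/2" and z: "z \<in> Omega a" and Re0: "Re z = 0"
  shows "\<bar>Im z\<bar> < a"
proof -
  have "xA > 0" by (simp add: xA_def add_pos_pos)
  with z Re0 have "\<bar>Im z\<bar> \<le> (a\<^sup>2) powr (3/4) / 2"
    by (simp add: Omega_def ybound_def)
  also have "(a\<^sup>2) powr (3/4) = a powr (3/2)"
    using a by (simp add: powr_powr flip: powr_numeral)
  also have "a powr (3/2) \<le> a powr 1"
    using a by (intro powr_mono') auto
  finally show ?thesis using a by simp
qed

text \<open>The plane slit along the two cuts of \<open>h a\<close>; it is star-shaped about 0.\<close>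

definition slit_plane :: "real \<Rightarrow> complex set" where
  "slit_plane a = {z. Re z = 0 \<longrightarrow> \<bar>Im z\<bar> < a}"

lemma Omega_subset_slit_plane:
  "\<lbrakk>0 < a; a \<le> 1/2\<rbrakk> \<Longrightarrow> Omega a \<subseteq> slit_plane a"
  using Omega_avoids_cut by (auto simp: slit_plane_def)

lemma open_slit_plane:
  "open (slit_plane a)"
proof -
  have "slit_plane a = {z. Re z < 0} \<union> {z. Re z > 0} \<union> {z. \<bar>Im z\<bar> < a}"
    by (auto simp: slit_plane_def)
  thus ?thesis
    by (auto intro!: open_Un open_Collect_less continuous_intros)
qed

lemma starlike_slit_plane:
  assumes "0 < a" shows "starlike (slit_plane a)"
  unfolding starlike_def
proof (intro bexI ballI subsetI)
  show "0 \<in> slit_plane a" using assms by (simp add: slit_plane_def)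
next
  fix z w assume z: "z \<in> slit_plane a" and w: "w \<in> closed_segment 0 z"
  then obtain u where u: "0 \<le> u" "u \<le> 1" "w = u *\<^sub>R z"
    by (auto simp: in_segment)
  have "u * \<bar>Im z\<bar> \<le> \<bar>Im z\<bar>" using u by (simp add: mult_left_le_one_le)
  with z u assms show "w \<in> slit_plane a"
    by (auto simp: slit_plane_def abs_mult)
qed

lemma h_derivative:
  assumes "0 < a" "z \<in> slit_plane a"
  shows "(h a has_field_derivative 1 / (z\<^sup>2 + (of_real a)\<^sup>2)) (at z)"
proof -
  have cut: "Re (z / of_real a) = 0 \<Longrightarrow> \<bar>Im (z / of_real a)\<bar> < 1"
    using assms by (simp add: slit_plane_def abs_divide)
  have "a \<noteq> 0" using assms by simp
  hence "((\<lambda>z. Arctan (z / of_real a)) has_field_derivative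
          inverse (1 + (z / of_real a)\<^sup>2) * (1 / of_real a)) (at z)"
    by (intro DERIV_chain2[where f = Arctan] has_field_derivative_Arctan cut)
       (auto intro!: derivative_eq_intros)
  from DERIV_cdivide[OF this, of "of_real a"]
  have "(h a has_field_derivative
          inverse (1 + (z / of_real a)\<^sup>2) * (1 / of_real a) / of_real a) (at z)"
    by (simp add: h_def[abs_def])
  also have "inverse (1 + (z / of_real a)\<^sup>2) * (1 / of_real a) / of_real a
               = 1 / ((1 + (z / of_real a)\<^sup>2) * (of_real a)\<^sup>2)"
    by (simp add: field_simps power2_eq_square)
  also have "(1 + (z / of_real a)\<^sup>2) * (of_real a)\<^sup>2 = z\<^sup>2 + (of_real a)\<^sup>2"
    using assms by (simp add: field_simps)
  finally show ?thesis .
qed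

lemma h_0: "h a 0 = 0"
  by (simp add: h_def)

lemma h_holomorphic:
  "0 < a \<Longrightarrow> h a holomorphic_on slit_plane a"
  using h_derivative open_slit_plane by (auto simp: holomorphic_on_open)

lemma g_holomorphic:
  assumes "0 < a" shows "g a holomorphic_on slit_plane a"
  unfolding g_def by (intro holomorphic_intros h_holomorphic assms)

lemma ybound_nonneg:
  assumes "0 < a" shows "0 \<le> ybound a x"
proof -
  have AB: "xA < xB" using pi_gt3 by (simp add: xA_def xB_def field_simps)
  have "0 \<le> yA a + (yB a - yA a) * ((\<bar>x\<bar> - xA) / (xB - xA))"
    if "\<not> \<bar>x\<bar> \<le> xA" "\<bar>x\<bar> \<le> xB"
  proof -
    define t where "t = (\<bar>x\<bar> - xA) / (xB - xA)"
    have "0 \<le> t" "t \<le> 1" using that AB by (auto simp: t_def)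
    moreover have "0 \<le> yA a" "0 \<le> yB a" by (auto simp: yA_def yB_def)
    moreover have "yA a + (yB a - yA a) * t = (1 - t) * yA a + t * yB a"
      by (simp add: algebra_simps)
    ultimately show ?thesis by (simp flip: t_def)
  qed
  thus ?thesis by (simp add: ybound_def)
qed

lemma path_in_Omega_exists:
  assumes "0 < a" and z: "z \<in> Omega a"
  shows "path_in_Omega a z (linepath 0 (of_real (Re z)) +++ linepath (of_real (Re z)) z)"
proof -
  have 1: "closed_segment 0 (of_real (Re z)) \<subseteq> Omega a"
    using ybound_nonneg[OF assms(1)] by (auto simp: in_segment Omega_def)
  have 2: "closed_segment (of_real (Re z)) z \<subseteq> Omega a"
  proof
    fix w assume "w \<in> closed_segment (of_real (Re z)) z"
    then obtain u where u: "0 \<le> u" "u \<le> 1"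
      and w: "w = (1 - u) *\<^sub>R of_real (Re z) + u *\<^sub>R z"
      by (auto simp: in_segment)
    have "Re w = Re z" "Im w = u * Im z" by (auto simp: w algebra_simps)
    moreover have "u * \<bar>Im z\<bar> \<le> \<bar>Im z\<bar>" using u by (simp add: mult_left_le_one_le)
    ultimately show "w \<in> Omega a" using z u by (simp add: Omega_def abs_mult)
  qed
  show ?thesis
    using 1 2 by (auto simp: path_in_Omega_def valid_path_join path_image_join)
qed

lemma F_eq_F_along:
  assumes a: "0 < a" "a \<le> 1/2" and \<gamma>: "path_in_Omega a z \<gamma>"
  shows "F a z = F_along a \<gamma>"
proof -
  define \<delta> where "\<delta> = (SOME \<gamma>. path_in_Omega a z \<gamma>)"
  have \<delta>: "path_in_Omega a z \<delta>" unfolding \<delta>_def by (rule someI[of "path_in_Omega a z", OF \<gamma>])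
  have eq: "contour_integral \<delta> f = contour_integral \<gamma> f"
    if f: "f holomorphic_on slit_plane a" for f
  proof -
    obtain p where "\<And>w. w \<in> slit_plane a \<Longrightarrow> (p has_field_derivative f w) (at w)"
      using holomorphic_starlike_primitive[of "slit_plane a" f "{}"] f
        open_slit_plane starlike_slit_plane[OF a(1)]
      by (auto simp: holomorphic_on_imp_continuous_on holomorphic_on_open
          field_differentiable_def)
    hence p: "\<And>w. w \<in> slit_plane a \<Longrightarrow> (p has_field_derivative f w) (at w within slit_plane a)"
      by (simp add: has_field_derivative_at_within)
    have "contour_integral \<eta> f = p z - p 0" if \<eta>: "path_in_Omega a z \<eta>" for \<eta>
      using contour_integral_primitive[OF p, of \<eta>] \<eta> Omega_subset_slit_plane[OF a]
      by (auto simp: path_in_Omega_def intro!: contour_integral_unique)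
    with \<delta> \<gamma> show ?thesis by simp
  qed
  have "g a \<zeta> \<noteq> 0" for \<zeta> by (simp add: g_def)
  thus ?thesis
    unfolding F_def \<delta>_def[symmetric] F_along_def
    using a by (simp add: eq holomorphic_intros g_holomorphic)
qed

end

theory Submission
  imports Defs
begin

text \<open>
  The reason is that the boundaries never leave a fixed ball. Above the point \<open>1\<close> of the real
  axis lies the boundary point \<open>z = 1 + i y\<close> of \<open>Omega a\<close>, where \<open>y = sqrt (1 + a\<^sup>2) / 2\<close>. The
  singularities \<open>\<plusminus>i a\<close> of \<open>h a\<close> run into the origin as \<open>a \<rightarrow> 0\<close>, but they stay at a definite
  distance from the segment \<open>[1, z]\<close>, where therefore \<open>h a\<close> varies by a bounded amount. As
  \<open>h a\<close> is real on the real axis, its imaginary part on the path \<open>[0, 1] \<union> [1, z]\<close> is bounded by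
  a constant not depending on \<open>a\<close>: this controls \<open>g a\<close>, whose modulus is \<open>exp (- Im (h a))\<close>, and
  its inverse (\<open>norm_g_le\<close>), although the derivative of \<open>h a\<close> at \<open>0\<close> blows up. Integrating the
  Weierstrass data along this path of length at most \<open>2\<close> gives a bound for \<open>F a z\<close> that is
  uniform in \<open>a\<close> (\<open>norm_F_le\<close>).

  By compactness the ball is contained in some member of any exhausting sequence of open sets, and
  this member then meets the boundary of the corresponding disk (\<open>compact_subset_exhaustion\<close>).
\<close>

lemma compact_subset_exhaustion:
  fixes U :: "nat \<Rightarrow> 'a::topological_space set"
  assumes "compact K" "\<And>i. open (U i)" "\<And>i. U i \<subseteq> U (Suc i)" "K \<subseteq> (\<Union>i. U i)"
  obtains n where "K \<subseteq> U n"
proof -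
  obtain I where I: "finite I" "K \<subseteq> (\<Union>i\<in>I. U i)"
    using compactE_image[of K UNIV U] assms by auto
  from I(1) obtain n where "\<forall>i\<in>I. i \<le> n"
    using finite_nat_set_iff_bounded_le by auto
  with I(2) have "K \<subseteq> U n"
    using lift_Suc_mono_le[of U, OF assms(3)] by blast
  thus thesis by (rule that)
qed

lemma norm_contour_integral_join_linepaths_le:
  assumes f: "continuous_on (closed_segment p q \<union> closed_segment q r) f"
    and B: "\<And>w. w \<in> closed_segment p q \<union> closed_segment q r \<Longrightarrow> norm (f w) \<le> B"
  shows "norm (contour_integral (linepath p q +++ linepath q r) f)
           \<le> B * (norm (q - p) + norm (r - q))"
proof -
  have "0 \<le> norm (f p)" by simp
  also have "\<dots> \<le> B" by (rule B) simp
  finally have "0 \<le> B" .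
  have int: "f contour_integrable_on linepath p q" "f contour_integrable_on linepath q r"
    using f by (auto intro!: contour_integrable_continuous_linepath elim: continuous_on_subset)
  have "norm (contour_integral (linepath p q) f) \<le> B * norm (q - p)"
    "norm (contour_integral (linepath q r) f) \<le> B * norm (r - q)"
    using int B \<open>0 \<le> B\<close> by (auto intro!: contour_integral_bound_linepath)
  with int show ?thesis
    by (simp add: distrib_left norm_triangle_mono)
qed

lemma ybound_eq_sqrt:
  assumes "1/2 \<le> \<bar>x\<bar>"
  shows "ybound a x = sqrt (x\<^sup>2 + a\<^sup>2) / 2"
proof -
  have "xA < 1/2" "xB < 1/2"
    using pi_gt3 by (auto simp: xA_def xB_def field_simps)
  with assms show ?thesis by (simp add: ybound_def powr_half_sqrt)
qed

lemma upper_edge_in_frontier_Omega: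
  assumes "0 < a"
  shows "Complex x (ybound a x) \<in> frontier (Omega a)"
proof -
  let ?z = "Complex x (ybound a x)"
  have "?z \<in> Omega a" using ybound_nonneg[OF assms] by (simp add: Omega_def)
  moreover have "?z \<notin> interior (Omega a)"
  proof
    assume "?z \<in> interior (Omega a)"
    then obtain e where e: "e > 0" "ball ?z e \<subseteq> Omega a"
      by (meson mem_interior)
    have "Complex x (ybound a x + e/2) \<in> ball ?z e"
      using e by (simp add: dist_norm cmod_def)
    with e have "Complex x (ybound a x + e/2) \<in> Omega a" by blast
    with e ybound_nonneg[OF assms, of x] show False by (simp add: Omega_def)
  qed
  ultimately show ?thesis
    using closure_subset by (auto simp: frontier_def)
qed

lemma Im_h_of_real: "Im (h a (of_real x)) = 0"
  using Im_Arctan_of_real[of "x / a"] by (simp add: h_def)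

text \<open>
  On the vertical segment above \<open>1\<close> the modulus of \<open>w\<^sup>2 + a\<^sup>2\<close> is at least its real part
  \<open>1 - (Im w)\<^sup>2 + a\<^sup>2 \<ge> 1/2\<close>, so there the derivative of \<open>h a\<close> has modulus at most \<open>2\<close>, whatever
  \<open>a\<close> is.
\<close>

lemma abs_Im_h_above_1_le:
  assumes a: "0 < a" and w: "Re w = 1" "(Im w)\<^sup>2 \<le> 1/2"
  shows "\<bar>Im (h a w)\<bar> \<le> 2"
proof -
  have w1: "closed_segment 1 w \<subseteq> {u. Re u = 1 \<and> (Im u)\<^sup>2 \<le> 1/2}"
  proof
    fix u assume "u \<in> closed_segment 1 w"
    then obtain t where t: "0 \<le> t" "t \<le> 1" "u = (1 - t) *\<^sub>R 1 + t *\<^sub>R w"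
      by (auto simp: in_segment)
    have "t\<^sup>2 * (Im w)\<^sup>2 \<le> 1 * (1/2)"
      using t w by (intro mult_mono) (auto simp: power_le_one)
    thus "u \<in> {u. Re u = 1 \<and> (Im u)\<^sup>2 \<le> 1/2}"
      using t w by (simp add: power_mult_distrib)
  qed
  have "norm (h a w - h a 1) \<le> 2 * norm (w - 1)"
  proof (rule field_differentiable_bound)
    show "(h a has_field_derivative 1 / (u\<^sup>2 + (of_real a)\<^sup>2)) (at u within closed_segment 1 w)"
      if "u \<in> closed_segment 1 w" for u
      using that w1 by (auto simp: slit_plane_def
          intro!: has_field_derivative_at_within[OF h_derivative[OF a]])
    show "norm (1 / (u\<^sup>2 + (of_real a)\<^sup>2)) \<le> 2" if "u \<in> closed_segment 1 w" for u
    proof -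
      have "Re u = 1" "(Im u)\<^sup>2 \<le> 1/2" using that w1 by auto
      hence "1/2 \<le> (Re u)\<^sup>2 - (Im u)\<^sup>2 + a\<^sup>2" by (simp add: add_increasing2)
      also have "\<dots> = Re (u\<^sup>2 + (of_real a)\<^sup>2)" by (simp add: Re_power2)
      also have "\<dots> \<le> norm (u\<^sup>2 + (of_real a)\<^sup>2)" by (rule complex_Re_le_cmod)
      finally show ?thesis by (auto simp: norm_divide divide_le_eq)
    qed
  qed auto
  also have "norm (w - 1) = \<bar>Im w\<bar>" using w by (simp add: cmod_def)
  also have "\<bar>Im w\<bar> \<le> 1" using w by (simp flip: abs_square_le_1)
  finally have "norm (h a w - h a 1) \<le> 2" by simp
  moreover have "\<bar>Im (h a w - h a 1)\<bar> \<le> norm (h a w - h a 1)" by (rule abs_Im_le_cmod)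
  moreover have "Im (h a 1) = 0" using Im_h_of_real[of a 1] by simp
  ultimately show ?thesis by simp
qed

lemma norm_g: "norm (g a z) = exp (- Im (h a z))"
  by (simp add: g_def)

lemma norm_g_le:
  assumes "\<bar>Im (h a z)\<bar> \<le> c"
  shows "norm (g a z) \<le> exp c" "norm (inverse (g a z)) \<le> exp c"
  using assms by (auto simp: norm_g norm_inverse simp flip: exp_minus)

lemma norm_F_le:
  assumes a: "0 < a" "a \<le> 1/2"
  shows "norm (F a (Complex 1 (ybound a 1))) \<le> 6 * exp 2"
proof -
  define z where "z = Complex 1 (ybound a 1)"
  define \<gamma> where "\<gamma> = linepath 0 1 +++ linepath 1 z"
  have "a\<^sup>2 \<le> (1/2)\<^sup>2" using a by (intro power_mono) auto
  hence y2: "(ybound a 1)\<^sup>2 \<le> 1/2"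
    by (simp add: ybound_eq_sqrt power_divide power2_eq_square)
  hence y1: "\<bar>ybound a 1\<bar> \<le> 1" by (simp flip: abs_square_le_1)
  have "z \<in> Omega a"
    using ybound_nonneg[OF a(1), of 1] by (simp add: z_def Omega_def)
  from path_in_Omega_exists[OF a(1) this] have \<gamma>: "path_in_Omega a z \<gamma>"
    by (simp add: \<gamma>_def z_def)
  have path: "closed_segment 0 1 \<union> closed_segment 1 z = path_image \<gamma>"
    by (simp add: \<gamma>_def path_image_join)
  have Im_h: "\<bar>Im (h a w)\<bar> \<le> 2" if "w \<in> path_image \<gamma>" for w
  proof -
    from that consider "w \<in> closed_segment 0 1" | "w \<in> closed_segment 1 z"
      by (auto simp flip: path)
    thus ?thesis
    proof cases
      case 1
      then obtain t where "w = of_real t" by (auto simp: in_segment scaleR_conv_of_real)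
      thus ?thesis by (simp add: Im_h_of_real)
    next
      case 2
      then obtain t where t: "0 \<le> t" "t \<le> 1" "w = (1 - t) *\<^sub>R 1 + t *\<^sub>R z"
        by (auto simp: in_segment)
      have "t\<^sup>2 * (ybound a 1)\<^sup>2 \<le> 1 * (1/2)"
        using t y2 by (intro mult_mono) (auto simp: power_le_one)
      with t show ?thesis
        by (intro abs_Im_h_above_1_le a) (auto simp: z_def power_mult_distrib)
    qed
  qed
  have bound: "\<bar>Re (contour_integral \<gamma> f)\<bar> \<le> 2 * exp 2"
    if f: "f holomorphic_on slit_plane a" "\<And>w. w \<in> path_image \<gamma> \<Longrightarrow> norm (f w) \<le> exp 2" for f
  proof -
    have "path_image \<gamma> \<subseteq> slit_plane a"
      using \<gamma> Omega_subset_slit_plane[OF a] by (auto simp: path_in_Omega_def)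
    hence "continuous_on (path_image \<gamma>) f"
      using f(1) holomorphic_on_imp_continuous_on continuous_on_subset by blast
    hence "norm (contour_integral (linepath 0 1 +++ linepath 1 z) f)
             \<le> exp 2 * (norm (1 - 0 :: complex) + norm (z - 1))"
      using f(2) by (intro norm_contour_integral_join_linepaths_le) (simp_all only: path)
    also have "\<dots> \<le> exp 2 * 2"
      using y1 by (simp add: z_def cmod_def)
    finally show ?thesis
      unfolding \<gamma>_def[symmetric] using abs_Re_le_cmod[of "contour_integral \<gamma> f"] by simp
  qed
  have g0: "g a w \<noteq> 0" for w by (simp add: g_def)
  have sum: "norm (inverse (g a w)) + norm (g a w) \<le> 2 * exp 2" if "w \<in> path_image \<gamma>" for w
    using norm_g_le[OF Im_h[OF that]] by simp
  have "\<bar>F a z $ 1\<bar> \<le> 2 * exp 2"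
    unfolding F_eq_F_along[OF a \<gamma>] F_along_def vector_3
  proof (rule bound)
    show "norm (1/2 * (inverse (g a w) - g a w)) \<le> exp 2" if "w \<in> path_image \<gamma>" for w
      using sum[OF that] norm_triangle_ineq4[of "inverse (g a w)" "g a w"]
      by (simp add: norm_mult)
  qed (intro holomorphic_intros g_holomorphic a g0)
  moreover have "\<bar>F a z $ 2\<bar> \<le> 2 * exp 2"
    unfolding F_eq_F_along[OF a \<gamma>] F_along_def vector_3
  proof (rule bound)
    show "norm (\<i>/2 * (inverse (g a w) + g a w)) \<le> exp 2" if "w \<in> path_image \<gamma>" for w
      using sum[OF that] norm_triangle_ineq[of "inverse (g a w)" "g a w"]
      by (simp add: norm_mult norm_divide)
  qed (intro holomorphic_intros g_holomorphic a g0)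
  moreover have "\<bar>F a z $ 3\<bar> \<le> 2 * exp 2"
    unfolding F_eq_F_along[OF a \<gamma>] F_along_def vector_3
    by (rule bound) auto
  ultimately show ?thesis
    using norm_le_l1_cart[of "F a z"] by (simp add: sum_3 flip: z_def)
qed

theorem proposition4p4:
  fixes a :: "nat \<Rightarrow> real" and U :: "nat \<Rightarrow> (real ^ 3) set"
  assumes "\<forall>i. 0 < a i \<and> a i \<le> 1/2"
    and "\<forall>i. open (U i)"
    and "\<forall>i. U i \<subseteq> U (Suc i)"
    and "(\<Union>i. U i) = UNIV"
  shows "\<not> (\<forall>i. Sigma_properly_embedded_in (a i) (U i))"
proof -
  obtain n where n: "cball 0 (6 * exp 2) \<subseteq> U n"
    using compact_subset_exhaustion[of "cball 0 (6 * exp 2)" U] assms(2-4) by auto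
  define p where "p = F (a n) (Complex 1 (ybound (a n) 1))"
  have "p \<in> Sigma_bdry (a n)"
    using upper_edge_in_frontier_Omega assms(1) by (auto simp: p_def Sigma_bdry_def)
  moreover have "p \<in> U n"
    using n norm_F_le[of "a n"] assms(1) by (auto simp: p_def)
  ultimately have "\<not> Sigma_properly_embedded_in (a n) (U n)"
    by (auto simp: Sigma_properly_embedded_in_def)
  thus ?thesis by blast
qed

end
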